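(* (Soundness of the symbolic-execution proof system for probabilistic dynamic logic.) For every finite set of formulae $\Gamma$ and every formula $\phi$ of probabilistic dynamic logic, if the judgment $\Gamma \Rightarrow \phi$ is derivable (i.e. there is a proof tree with root $\Gamma \Rightarrow \phi$ built from the rules described below whose collected side conditions are jointly satisfiable), then $\models (\bigwedge \Gamma) \rightarrow \phi$, i.e. $\epsilon \models (\bigwedge\Gamma)\rightarrow\phi$ for every valuation $\epsilon$, where the probability variables occurring in the judgment are interpreted by a satisfying assignment of the side conditions.
   Context: \textbf{Programs (pGCL).} Expressions $e$ are built from values ($\mathit{true},\mathit{false},0,1,\dots$), program variables $x\in X$, and operators $+,-,*,/,>,==,\geq$. Statements are $s ::= s\sqcap s \mid s \oplus_e s \mid s;s \mid \mathtt{skip} \mid x:=e \mid \mathtt{if}\ e\ \{s\}\ \mathtt{else}\ \{s\} \mid \mathtt{while}\ e\ \{s\}$, where $s_1\sqcap s_2$ is nondeterministic (demonic) choice and $s_1\oplus_e s_2$ is probabilistic choice executing $s_1$ with probability $\epsilon(e)\in[0,1]$ and $s_2$ with probability $1-\epsilon(e)$. \textbf{Semantics.} A program $s$ denotes a Markov decision process $\mathcal M_s$ whose states are pairs $\langle\epsilon,s'\rangle$ of a valuation $\epsilon$ (mapping variables to values) and a remaining program; $\langle\epsilon,\mathtt{skip}\rangle$ is final. A policy $\pi$ resolves demonic choices: $\pi\langle\epsilon,s_1\sqcap s_2\rangle\in\{s_1,s_2\}$. Given $\pi$, transitions $\xrightarrow{p}_\pi$ are: $\langle\epsilon,x:=e\rangle\xrightarrow{1}\langle\epsilon[x\mapsto\epsilon(e)],\mathtt{skip}\rangle$;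 if $\langle\epsilon,s_2\rangle\xrightarrow{p}\langle\epsilon',s\rangle$ then $\langle\epsilon,\mathtt{skip};s_2\rangle\xrightarrow{p}\langle\epsilon',s\rangle$; if $\langle\epsilon,s_1\rangle\xrightarrow{p}\langle\epsilon',s\rangle$ then $\langle\epsilon,s_1;s_2\rangle\xrightarrow{p}\langle\epsilon',s;s_2\rangle$; $\langle\epsilon,s_1\sqcap s_2\rangle\xrightarrow{1}\langle\epsilon,s_i\rangle$ where $s_i=\pi\langle\epsilon,s_1\sqcap s_2\rangle$; $\mathtt{if}$ goes with probability 1 to $s_1$ if $\epsilon(e)=\mathit{true}$ and to $s_2$ if $\epsilon(e)=\mathit{false}$; $\langle\epsilon,s_1\oplus_e s_2\rangle\xrightarrow{p}\langle\epsilon,s_1\rangle$ and $\xrightarrow{1-p}\langle\epsilon,s_2\rangle$ where $p=\epsilon(e)\in[0,1]$; $\langle\epsilon,\mathtt{while}\ e\ \{s\}\rangle\xrightarrow{1}\langle\epsilon,s;\mathtt{while}\ e\ \{s\}\rangle$ if $\epsilon(e)=\mathit{true}$ and $\xrightarrow{1}\langle\epsilon,\mathtt{skip}\rangle$ otherwise. The probability of a path to a final state is the product of its transition probabilities. For a reward $r$ on final states, $\mathbb E_\sigma(r)=\inf_\pi\sum_{\bar\sigma}\Pr(\bar\sigma)\,r(\mathrm{last}(\bar\sigma))$, summing over paths under $\pi$ from $\sigma$ to final states. Standing assumption: all programs considered terminate with probability 1 under every policy. \textbf{Formulae (pDL).} With program variables $X$ and disjoint logical variables $L$, formulae are $\phi::=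 A\mid\neg\phi\mid\phi_1\wedge\phi_2\mid\forall l\cdot\phi\mid[s]_p\,\phi\mid\{U\}\phi$, where $A$ is an atomic first-order formula over program/logical variables, and updates are $U::=\mathsf{empty}\mid x\mapsto t$ for a term $t$. Satisfaction: atomic, $\neg$, $\wedge$, $\forall$ as usual; $\llbracket\mathsf{empty}\rrbracket(\epsilon)=\epsilon$, $\llbracket x\mapsto t\rrbracket(\epsilon)=\epsilon[x\mapsto\epsilon(t)]$, and $\epsilon\models\{U\}\phi$ iff $\llbracket U\rrbracket(\epsilon)\models\phi$; $\epsilon\models[s]_p\phi$ iff $p(\epsilon)\le\mathbb E_{\langle\epsilon,s\rangle}([\phi])$ in $\mathcal M_s$, where $[\phi]$ is the indicator of $\phi$ holding in the final state. $\mathcal U$ denotes a finite sequence of update applications $\{U_1\}\cdots\{U_n\}$; $\mathcal U(e)$ is the expression/formula $e$ under these updates. \textbf{Judgments and rules.} A judgment $\Gamma\Rightarrow\phi$ expresses validity of $\bigwedge\Gamma\rightarrow\phi$. Probability annotations $p,p_1,p_2$ are probability variables (not depending on program state) ranging over $[0,1]$, and side conditions are (in)equalities between them. Besides standard sound first-order rules, the rules are (premises $\Rightarrow$ conclusion, side condition in brackets): skip: from $\Gamma\Rightarrow\mathcal U[s]_p\phi$ infer $\Gamma\Rightarrow\mathcal U[\mathtt{skip};s]_p\phi$. assign: from $\Gamma\Rightarrow\mathcal U\{x\mapsto e\}[s]_p\phi$ infer $\Gamma\Rightarrow\mathcal U[x:=e;s]_p\phi$. empty1: from $\Gamma\Rightarrow\mathcal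 U(\phi)$ infer $\Gamma\Rightarrow\mathcal U[\mathtt{skip}]_p\phi$ [$p=1$]. empty0: with no premise infer $\Gamma\Rightarrow\mathcal U[\mathtt{skip}]_p\phi$ [$p=0$]. demonChoice: from $\Gamma\Rightarrow\mathcal U[s_1;s]_{p_1}\phi$ and $\Gamma\Rightarrow\mathcal U[s_2;s]_{p_2}\phi$ infer $\Gamma\Rightarrow\mathcal U[(s_1\sqcap s_2);s]_p\phi$ [$p\le\min(p_1,p_2)$]. probChoice: from $\Gamma\Rightarrow\mathcal U[s_1;s]_{p_1}\phi$ and $\Gamma\Rightarrow\mathcal U[s_2;s]_{p_2}\phi$ infer $\Gamma\Rightarrow\mathcal U[(s_1\oplus_e s_2);s]_p\phi$ [$p\le e\cdot p_1+(1-e)\cdot p_2$]. if: from $\Gamma,\mathcal U(e)\Rightarrow\mathcal U[s_1;s]_p\phi$ and $\Gamma,\neg\mathcal U(e)\Rightarrow\mathcal U[s_2;s]_p\phi$ infer $\Gamma\Rightarrow\mathcal U[\mathtt{if}\ (e)\{s_1\}\ \mathtt{else}\ \{s_2\};s]_p\phi$. loopUnroll: from $\Gamma\Rightarrow\mathcal U[\mathtt{if}\ (e)\ \{s_b;\mathtt{while}\ (e)\ \{s_b\};s\}\ \mathtt{else}\ s]_p\phi$ infer $\Gamma\Rightarrow\mathcal U[\mathtt{while}\ (e)\ \{s_b\};s]_p\phi$. A judgment is derivable if there exists a finite proof tree with it as root, built from these rules, whose set of side conditions is satisfiable. *)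

theory Defs
  imports "HOL-Probability.Probability" "HOL-Library.FSet"
begin

section \<open>Expressions and programs\<close>

datatype val = VBool bool | VNum real

datatype binop = Plus | Minus | Times | Div | Gt | Eq | Ge

text \<open>Program expressions are \<open>'x exp\<close> over the program variables \<open>'x\<close>; terms of the logic are
  \<open>('x + 'l) exp\<close>, which may also mention the (disjoint) logical variables \<open>'l\<close>.\<close>

datatype 'v exp = Val val | Var 'v | Op binop "'v exp" "'v exp"

text \<open>Evaluation is total: Boolean operands of numeric operators are read as 0 or 1, and
  division by zero yields 0.\<close>

fun num :: "val \<Rightarrow> real" where
  "num (VNum r) = r"
| "num (VBool b) = of_bool b"

fun binop_sem :: "binop \<Rightarrow> val \<Rightarrow> val \<Rightarrow> val" where
  "binop_sem Plus v w = VNum (num v + num w)"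
| "binop_sem Minus v w = VNum (num v - num w)"
| "binop_sem Times v w = VNum (num v * num w)"
| "binop_sem Div v w = VNum (num v / num w)"
| "binop_sem Gt v w = VBool (num v > num w)"
| "binop_sem Eq v w = VBool (v = w)"
| "binop_sem Ge v w = VBool (num v \<ge> num w)"

primrec eval :: "('v \<Rightarrow> val) \<Rightarrow> 'v exp \<Rightarrow> val" where
  "eval \<epsilon> (Val v) = v"
| "eval \<epsilon> (Var x) = \<epsilon> x"
| "eval \<epsilon> (Op f a b) = binop_sem f (eval \<epsilon> a) (eval \<epsilon> b)"

datatype 'x stmt =
    Demon "'x stmt" "'x stmt"
  | PChoice "'x stmt" "'x exp" "'x stmt"
  | Seq "'x stmt" "'x stmt"  (infixr \<open>;;\<close> 60)
  | Skip
  | Assign 'x "'x exp"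
  | IfElse "'x exp" "'x stmt" "'x stmt"
  | While "'x exp" "'x stmt"

section \<open>The Markov decision process of a program\<close>

type_synonym 'x state = "('x \<Rightarrow> val) \<times> 'x stmt"

type_synonym 'x policy = "'x state \<Rightarrow> 'x stmt"

definition is_policy :: "'x policy \<Rightarrow> bool" where
  "is_policy \<pi> \<longleftrightarrow> (\<forall>\<epsilon> s\<^sub>1 s\<^sub>2. \<pi> (\<epsilon>, Demon s\<^sub>1 s\<^sub>2) \<in> {s\<^sub>1, s\<^sub>2})"

text \<open>\<open>step \<pi> \<epsilon> s\<close> is the distribution of the successors of \<open>(\<epsilon>, s)\<close> under \<open>\<pi>\<close>, and \<open>None\<close> if there
  is no transition: at \<open>Skip\<close>, at a conditional whose guard is not a Boolean, and at a probabilistic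
  choice whose expression is not a number in \<open>[0,1]\<close>. The distribution adds up the two branches
  of a probabilistic choice when they lead to the same state.

  \<open>Skip ;; s\<close> makes the transitions of \<open>s\<close>. As \<open>Skip\<close> makes none, that would leave
  \<open>Skip ;; Skip\<close> stuck without being final, so it is given a transition to \<open>Skip\<close>.\<close>

primrec step :: "'x policy \<Rightarrow> ('x \<Rightarrow> val) \<Rightarrow> 'x stmt \<Rightarrow> 'x state pmf option" where
  "step \<pi> \<epsilon> (Demon s\<^sub>1 s\<^sub>2) = Some (return_pmf (\<epsilon>, \<pi> (\<epsilon>, Demon s\<^sub>1 s\<^sub>2)))"
| "step \<pi> \<epsilon> (PChoice s\<^sub>1 e s\<^sub>2) =
     (case eval \<epsilon> e of
        VNum p \<Rightarrow> (if 0 \<le> p \<and> p \<le> 1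
                   then Some (map_pmf (\<lambda>b. (\<epsilon>, if b then s\<^sub>1 else s\<^sub>2)) (bernoulli_pmf p))
                   else None)
      | VBool _ \<Rightarrow> None)"
| "step \<pi> \<epsilon> (s\<^sub>1 ;; s\<^sub>2) =
     (if s\<^sub>1 = Skip
      then (if s\<^sub>2 = Skip then Some (return_pmf (\<epsilon>, Skip)) else step \<pi> \<epsilon> s\<^sub>2)
      else map_option (map_pmf (\<lambda>(\<epsilon>', s). (\<epsilon>', s ;; s\<^sub>2))) (step \<pi> \<epsilon> s\<^sub>1))"
| "step \<pi> \<epsilon> Skip = None"
| "step \<pi> \<epsilon> (Assign x e) = Some (return_pmf (\<epsilon>(x := eval \<epsilon> e), Skip))"
| "step \<pi> \<epsilon> (IfElse e s\<^sub>1 s\<^sub>2) =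
     (case eval \<epsilon> e of
        VBool b \<Rightarrow> Some (return_pmf (\<epsilon>, if b then s\<^sub>1 else s\<^sub>2))
      | VNum _ \<Rightarrow> None)"
| "step \<pi> \<epsilon> (While e s) =
     Some (return_pmf (\<epsilon>, if eval \<epsilon> e = VBool True then s ;; While e s else Skip))"

definition trans_prob :: "'x policy \<Rightarrow> 'x state \<Rightarrow> 'x state \<Rightarrow> real" where
  "trans_prob \<pi> \<sigma> \<sigma>' = (case step \<pi> (fst \<sigma>) (snd \<sigma>) of None \<Rightarrow> 0 | Some D \<Rightarrow> pmf D \<sigma>')"

definition final :: "'x state \<Rightarrow> bool" where
  "final \<sigma> \<longleftrightarrow> snd \<sigma> = Skip"

definition final_paths :: "'x policy \<Rightarrow> 'x state \<Rightarrow> 'x state list set" where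
  "final_paths \<pi> \<sigma> =
     {\<omega>. \<omega> \<noteq> [] \<and> hd \<omega> = \<sigma> \<and> final (last \<omega>) \<and>
         (\<forall>i. Suc i < length \<omega> \<longrightarrow> trans_prob \<pi> (\<omega> ! i) (\<omega> ! Suc i) > 0)}"

definition path_prob :: "'x policy \<Rightarrow> 'x state list \<Rightarrow> real" where
  "path_prob \<pi> \<omega> = (\<Prod>i<length \<omega> - 1. trans_prob \<pi> (\<omega> ! i) (\<omega> ! Suc i))"

definition expected :: "'x state \<Rightarrow> ('x state \<Rightarrow> real) \<Rightarrow> real" where
  "expected \<sigma> r =
     (INF \<pi>\<in>{\<pi>. is_policy \<pi>}. \<Sum>\<^sub>\<infinity>\<omega>\<in>final_paths \<pi> \<sigma>. path_prob \<pi> \<omega> * r (last \<omega>))"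

definition terminates :: "'x stmt \<Rightarrow> bool" where
  "terminates s \<longleftrightarrow>
     (\<forall>\<epsilon> \<pi>. is_policy \<pi> \<longrightarrow> (\<Sum>\<^sub>\<infinity>\<omega>\<in>final_paths \<pi> (\<epsilon>, s). path_prob \<pi> \<omega>) = 1)"

section \<open>Probabilistic dynamic logic\<close>

datatype ('x, 'l) upd = NoUpd | Update 'x "('x + 'l) exp"

text \<open>\<open>'p\<close> is the type of probability variables. An atomic formula is a term, which holds
  if its value is \<open>true\<close>.\<close>

datatype ('x, 'l, 'p) fml =
    Atom "('x + 'l) exp"
  | Neg "('x, 'l, 'p) fml"
  | Conj "('x, 'l, 'p) fml" "('x, 'l, 'p) fml"
  | Forall 'l "('x, 'l, 'p) fml"
  | Box "'x stmt" 'p "('x, 'l, 'p) fml"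
  | Upd "('x, 'l) upd" "('x, 'l, 'p) fml"

text \<open>A valuation consists of a part \<open>\<epsilon>\<close> for program variables, which programs and updates change,
  and a part \<open>\<eta>\<close> for logical variables, which quantifiers change.\<close>

primrec upd_sem :: "('l \<Rightarrow> val) \<Rightarrow> ('x \<Rightarrow> val) \<Rightarrow> ('x, 'l) upd \<Rightarrow> ('x \<Rightarrow> val)" where
  "upd_sem \<eta> \<epsilon> NoUpd = \<epsilon>"
| "upd_sem \<eta> \<epsilon> (Update x t) = \<epsilon>(x := eval (case_sum \<epsilon> \<eta>) t)"

primrec sat :: "('p \<Rightarrow> real) \<Rightarrow> ('l \<Rightarrow> val) \<Rightarrow> ('x \<Rightarrow> val) \<Rightarrow> ('x, 'l, 'p) fml \<Rightarrow> bool" where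
  "sat \<rho> \<eta> \<epsilon> (Atom t) \<longleftrightarrow> eval (case_sum \<epsilon> \<eta>) t = VBool True"
| "sat \<rho> \<eta> \<epsilon> (Neg \<phi>) \<longleftrightarrow> \<not> sat \<rho> \<eta> \<epsilon> \<phi>"
| "sat \<rho> \<eta> \<epsilon> (Conj \<phi> \<psi>) \<longleftrightarrow> sat \<rho> \<eta> \<epsilon> \<phi> \<and> sat \<rho> \<eta> \<epsilon> \<psi>"
| "sat \<rho> \<eta> \<epsilon> (Forall l \<phi>) \<longleftrightarrow> (\<forall>v. sat \<rho> (\<eta>(l := v)) \<epsilon> \<phi>)"
| "sat \<rho> \<eta> \<epsilon> (Box s p \<phi>) \<longleftrightarrow>
     \<rho> p \<le> expected (\<epsilon>, s) (\<lambda>\<sigma>. of_bool (sat \<rho> \<eta> (fst \<sigma>) \<phi>))"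
| "sat \<rho> \<eta> \<epsilon> (Upd u \<phi>) \<longleftrightarrow> sat \<rho> \<eta> (upd_sem \<eta> \<epsilon> u) \<phi>"

primrec programs :: "('x, 'l, 'p) fml \<Rightarrow> 'x stmt set" where
  "programs (Atom t) = {}"
| "programs (Neg \<phi>) = programs \<phi>"
| "programs (Conj \<phi> \<psi>) = programs \<phi> \<union> programs \<psi>"
| "programs (Forall l \<phi>) = programs \<phi>"
| "programs (Box s p \<phi>) = insert s (programs \<phi>)"
| "programs (Upd u \<phi>) = programs \<phi>"

definition Upds :: "('x, 'l) upd list \<Rightarrow> ('x, 'l, 'p) fml \<Rightarrow> ('x, 'l, 'p) fml" where
  "Upds us \<phi> = foldr Upd us \<phi>"

definition upds_sem :: "('l \<Rightarrow> val) \<Rightarrow> ('x \<Rightarrow> val) \<Rightarrow> ('x, 'l) upd list \<Rightarrow> ('x \<Rightarrow> val)" where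
  "upds_sem \<eta> \<epsilon> us = foldl (upd_sem \<eta>) \<epsilon> us"

section \<open>Proof trees\<close>

datatype ('x, 'l, 'p) sequent =
  Sequent "('x, 'l, 'p) fml fset" "('x, 'l, 'p) fml"  (infix \<open>\<turnstile>\<close> 50)

fun sequent_programs :: "('x, 'l, 'p) sequent \<Rightarrow> 'x stmt set" where
  "sequent_programs (\<Gamma> \<turnstile> \<phi>) = (\<Union>\<psi>\<in>insert \<phi> (fset \<Gamma>). programs \<psi>)"

definition sat_imp ::
  "('p \<Rightarrow> real) \<Rightarrow> ('l \<Rightarrow> val) \<Rightarrow> ('x \<Rightarrow> val) \<Rightarrow> ('x, 'l, 'p) fml fset \<Rightarrow> ('x, 'l, 'p) fml \<Rightarrow> bool" where
  "sat_imp \<rho> \<eta> \<epsilon> \<Gamma> \<phi> \<longleftrightarrow> ((\<forall>\<psi>. \<psi> |\<in>| \<Gamma> \<longrightarrow> sat \<rho> \<eta> \<epsilon> \<psi>) \<longrightarrow> sat \<rho> \<eta> \<epsilon> \<phi>)"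

fun valid :: "('p \<Rightarrow> real) \<Rightarrow> ('x, 'l, 'p) sequent \<Rightarrow> bool" where
  "valid \<rho> (\<Gamma> \<turnstile> \<phi>) \<longleftrightarrow> (\<forall>\<eta> \<epsilon>. sat_imp \<rho> \<eta> \<epsilon> \<Gamma> \<phi>)"

definition prob_assignment :: "('p \<Rightarrow> real) \<Rightarrow> bool" where
  "prob_assignment \<rho> \<longleftrightarrow> (\<forall>p. 0 \<le> \<rho> p \<and> \<rho> p \<le> 1)"

text \<open>\<open>LeMix p us e p\<^sub>1 p\<^sub>2\<close> is \<open>p \<le> e \<cdot> p\<^sub>1 + (1 - e) \<cdot> p\<^sub>2\<close>, with \<open>e\<close> read under the updates \<open>us\<close>.
  Probability variables do not depend on the state but \<open>e\<close> may, so the inequality is required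
  for all valuations.\<close>

datatype ('x, 'l, 'p) side_cond =
    IsOne 'p
  | IsZero 'p
  | LeMin 'p 'p 'p
  | LeMix 'p "('x, 'l) upd list" "'x exp" 'p 'p

primrec cond_holds :: "('p \<Rightarrow> real) \<Rightarrow> ('x, 'l, 'p) side_cond \<Rightarrow> bool" where
  "cond_holds \<rho> (IsOne p) \<longleftrightarrow> \<rho> p = 1"
| "cond_holds \<rho> (IsZero p) \<longleftrightarrow> \<rho> p = 0"
| "cond_holds \<rho> (LeMin p p\<^sub>1 p\<^sub>2) \<longleftrightarrow> \<rho> p \<le> min (\<rho> p\<^sub>1) (\<rho> p\<^sub>2)"
| "cond_holds \<rho> (LeMix p us e p\<^sub>1 p\<^sub>2) \<longleftrightarrow>
     (\<forall>\<eta> \<epsilon>. let v = num (eval (upds_sem \<eta> \<epsilon> us) e) in \<rho> p \<le> v * \<rho> p\<^sub>1 + (1 - v) * \<rho> p\<^sub>2)"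

definition satisfies :: "('p \<Rightarrow> real) \<Rightarrow> ('x, 'l, 'p) side_cond set \<Rightarrow> bool" where
  "satisfies \<rho> C \<longleftrightarrow> prob_assignment \<rho> \<and> (\<forall>c\<in>C. cond_holds \<rho> c)"

definition satisfiable :: "('x, 'l, 'p) side_cond set \<Rightarrow> bool" where
  "satisfiable C \<longleftrightarrow> (\<exists>\<rho>. satisfies \<rho> C)"

abbreviation term_of_exp :: "'x exp \<Rightarrow> ('x + 'l) exp" where
  "term_of_exp e \<equiv> map_exp Inl e"

text \<open>The first-order part of the calculus is a parameter: a set of rule instances, each a list
  of premises with a conclusion.\<close>

type_synonym ('x, 'l, 'p) rules = "(('x, 'l, 'p) sequent list \<times> ('x, 'l, 'p) sequent) set"

definition sound_rules :: "('x, 'l, 'p) rules \<Rightarrow> bool" where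
  "sound_rules R \<longleftrightarrow>
     (\<forall>(js, j)\<in>R. \<forall>\<rho>. prob_assignment \<rho> \<longrightarrow> (\<forall>i\<in>set js. valid \<rho> i) \<longrightarrow> valid \<rho> j)"

inductive infer ::
  "('x, 'l, 'p) rules \<Rightarrow> ('x, 'l, 'p) sequent list \<Rightarrow> ('x, 'l, 'p) side_cond set \<Rightarrow>
   ('x, 'l, 'p) sequent \<Rightarrow> bool" for R where
  fo: "(js, j) \<in> R \<Longrightarrow> infer R js {} j"
| skip: "infer R [\<Gamma> \<turnstile> Upds us (Box s p \<phi>)] {}
    (\<Gamma> \<turnstile> Upds us (Box (Skip ;; s) p \<phi>))"
| assign: "infer R [\<Gamma> \<turnstile> Upds us (Upd (Update x (term_of_exp e)) (Box s p \<phi>))] {}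
    (\<Gamma> \<turnstile> Upds us (Box (Assign x e ;; s) p \<phi>))"
| empty1: "infer R [\<Gamma> \<turnstile> Upds us \<phi>] {IsOne p}
    (\<Gamma> \<turnstile> Upds us (Box Skip p \<phi>))"
| empty0: "infer R [] {IsZero p}
    (\<Gamma> \<turnstile> Upds us (Box Skip p \<phi>))"
| demonChoice: "infer R
    [\<Gamma> \<turnstile> Upds us (Box (s\<^sub>1 ;; s) p\<^sub>1 \<phi>), \<Gamma> \<turnstile> Upds us (Box (s\<^sub>2 ;; s) p\<^sub>2 \<phi>)] {LeMin p p\<^sub>1 p\<^sub>2}
    (\<Gamma> \<turnstile> Upds us (Box (Demon s\<^sub>1 s\<^sub>2 ;; s) p \<phi>))"
| probChoice: "infer R
    [\<Gamma> \<turnstile> Upds us (Box (s\<^sub>1 ;; s) p\<^sub>1 \<phi>), \<Gamma> \<turnstile> Upds us (Box (s\<^sub>2 ;; s) p\<^sub>2 \<phi>)] {LeMix p us e p\<^sub>1 p\<^sub>2}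
    (\<Gamma> \<turnstile> Upds us (Box (PChoice s\<^sub>1 e s\<^sub>2 ;; s) p \<phi>))"
| cond: "infer R
    [finsert (Upds us (Atom (term_of_exp e))) \<Gamma> \<turnstile> Upds us (Box (s\<^sub>1 ;; s) p \<phi>),
     finsert (Neg (Upds us (Atom (term_of_exp e)))) \<Gamma> \<turnstile> Upds us (Box (s\<^sub>2 ;; s) p \<phi>)] {}
    (\<Gamma> \<turnstile> Upds us (Box (IfElse e s\<^sub>1 s\<^sub>2 ;; s) p \<phi>))"
| loopUnroll: "infer R [\<Gamma> \<turnstile> Upds us (Box (IfElse e (s\<^sub>b ;; While e s\<^sub>b ;; s) s) p \<phi>)] {}
    (\<Gamma> \<turnstile> Upds us (Box (While e s\<^sub>b ;; s) p \<phi>))"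

datatype ('x, 'l, 'p) tree =
  Node (concl: "('x, 'l, 'p) sequent") "('x, 'l, 'p) side_cond set" "('x, 'l, 'p) tree list"

inductive proof_tree :: "('x, 'l, 'p) rules \<Rightarrow> ('x, 'l, 'p) tree \<Rightarrow> bool" for R where
  "infer R (map concl ts) C j \<Longrightarrow> (\<And>t. t \<in> set ts \<Longrightarrow> proof_tree R t) \<Longrightarrow> proof_tree R (Node j C ts)"

primrec side_conds :: "('x, 'l, 'p) tree \<Rightarrow> ('x, 'l, 'p) side_cond set" where
  "side_conds (Node j C ts) = C \<union> \<Union> (set (map side_conds ts))"

primrec tree_programs :: "('x, 'l, 'p) tree \<Rightarrow> 'x stmt set" where
  "tree_programs (Node j C ts) = sequent_programs j \<union> \<Union> (set (map tree_programs ts))"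

end

theory Submission
  imports Defs
begin

text \<open>Under a fixed policy, every statement has at most one successor distribution, of finite support,
  and the expected reward of a state is the average of the rewards of its successors. All rules except
  \<open>loopUnroll\<close> are instances of this equation, applied policy by policy. \<open>loopUnroll\<close> also reassociates a
  sequential composition, which may change the number of steps. Rewards are compared there
  by a least fixed point argument: the reward lies below every nonnegative supersolution
  of the averaging equation.\<close>

section \<open>Expected rewards under a fixed policy\<close>

text \<open>The sum under the infimum that defines \<open>expected\<close>, isolated so that rules
  can be checked policy by policy.\<close>

definition reward :: "'x policy \<Rightarrow> ('x state \<Rightarrow> real) \<Rightarrow> 'x state \<Rightarrow> real" where
  "reward \<pi> r \<sigma> = (\<Sum>\<^sub>\<infinity>\<omega>\<in>final_paths \<pi> \<sigma>. path_prob \<pi> \<omega> * r (last \<omega>))"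

text \<open>Only a probabilistic choice branches, and only in two. Finite support makes every
  function integrable and turns expectations into finite sums.\<close>

lemma finite_set_pmf_step: "step \<pi> \<epsilon> s = Some D \<Longrightarrow> finite (set_pmf D)"
  by (induction s arbitrary: D) (auto split: val.splits if_splits)

section \<open>Paths to final states and their probabilities\<close>

lemma trans_prob_nonneg: "0 \<le> trans_prob \<pi> \<sigma> \<sigma>'"
  by (auto simp: trans_prob_def split: option.split)

lemma path_prob_nonneg: "0 \<le> path_prob \<pi> \<omega>"
  by (simp add: path_prob_def prod_nonneg trans_prob_nonneg)

lemma path_prob_Cons:
  assumes "\<omega> \<noteq> []"
  shows "path_prob \<pi> (\<sigma> # \<omega>) = trans_prob \<pi> \<sigma> (hd \<omega>) * path_prob \<pi> \<omega>"
proof -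
  obtain n where n: "length \<omega> = Suc n" using assms by (cases \<omega>) auto
  show ?thesis
    using assms by (simp add: path_prob_def n prod.lessThan_Suc_shift hd_conv_nth del: prod.lessThan_Suc)
qed

lemma Cons_in_final_paths_iff:
  assumes "\<omega> \<noteq> []"
  shows "\<sigma>' # \<omega> \<in> final_paths \<pi> \<sigma> \<longleftrightarrow>
    \<sigma>' = \<sigma> \<and> trans_prob \<pi> \<sigma> (hd \<omega>) > 0 \<and> \<omega> \<in> final_paths \<pi> (hd \<omega>)"
  using assms by (auto simp: final_paths_def All_less_Suc2 nth_Cons hd_conv_nth split: nat.splits)

lemma final_paths_Skip: "final_paths \<pi> (\<epsilon>, Skip) = {[(\<epsilon>, Skip)]}"
proof -
  have "\<omega> = [(\<epsilon>, Skip)]" if "\<omega> \<in> final_paths \<pi> (\<epsilon>, Skip)" for \<omega>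
  proof (cases \<omega>)
    case Nil
    with that show ?thesis by (simp add: final_paths_def)
  next
    case (Cons \<sigma> \<omega>')
    with that show ?thesis
      by (cases "\<omega>' = []") (auto simp: Cons_in_final_paths_iff trans_prob_def final_paths_def)
  qed
  then show ?thesis by (auto simp: final_paths_def final_def)
qed

text \<open>A nonfinal state without transitions contributes no path, so its reward and its
  probability of termination are both 0.\<close>

lemma final_paths_stuck:
  assumes "step \<pi> \<epsilon> s = None" "s \<noteq> Skip"
  shows "final_paths \<pi> (\<epsilon>, s) = {}"
proof -
  have "\<omega> \<notin> final_paths \<pi> (\<epsilon>, s)" for \<omega>
  proof (cases \<omega>)
    case Nil
    then show ?thesis by (simp add: final_paths_def)
  next
    case (Cons \<sigma> \<omega>')
    with assms show ?thesis
      by (cases "\<omega>' = []") (auto simp: Cons_in_final_paths_iff trans_prob_def final_paths_def final_def)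
  qed
  then show ?thesis by blast
qed

text \<open>\<open>final_paths\<close> admits only transitions of positive probability, which is why
  the successors range over the support of \<open>D\<close>.\<close>

lemma final_paths_step:
  assumes "step \<pi> \<epsilon> s = Some D"
  shows "final_paths \<pi> (\<epsilon>, s) = Cons (\<epsilon>, s) ` (\<Union>\<sigma>\<in>set_pmf D. final_paths \<pi> \<sigma>)"
proof -
  have pos: "trans_prob \<pi> (\<epsilon>, s) \<sigma> > 0 \<longleftrightarrow> \<sigma> \<in> set_pmf D" for \<sigma>
    using assms by (auto simp: trans_prob_def pmf_positive_iff)
  have "s \<noteq> Skip" using assms by auto
  have "\<omega> \<in> Cons (\<epsilon>, s) ` (\<Union>\<sigma>\<in>set_pmf D. final_paths \<pi> \<sigma>)"
    if "\<omega> \<in> final_paths \<pi> (\<epsilon>, s)" for \<omega>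
  proof (cases \<omega>)
    case Nil
    with that show ?thesis by (simp add: final_paths_def)
  next
    case (Cons \<sigma> \<omega>')
    with that \<open>s \<noteq> Skip\<close> have "\<omega>' \<noteq> []" by (auto simp: final_paths_def final_def)
    with that Cons show ?thesis by (auto simp: Cons_in_final_paths_iff pos)
  qed
  moreover have "(\<epsilon>, s) # \<omega> \<in> final_paths \<pi> (\<epsilon>, s)"
    if "\<sigma> \<in> set_pmf D" "\<omega> \<in> final_paths \<pi> \<sigma>" for \<sigma> \<omega>
  proof -
    have "\<omega> \<noteq> []" "hd \<omega> = \<sigma>" using that by (auto simp: final_paths_def)
    with that show ?thesis by (simp add: Cons_in_final_paths_iff pos)
  qed
  ultimately show ?thesis by blast
qed

text \<open>Summability of path probabilities and comparison of the rewards of different programs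
  both come down to exhibiting a supersolution \<open>g\<close>.\<close>

lemma sum_final_paths_le_supersolution:
  assumes "\<And>\<sigma>. 0 \<le> r \<sigma>" and "\<And>\<sigma>. 0 \<le> g \<sigma>"
    and Skip: "\<And>\<epsilon>. r (\<epsilon>, Skip) \<le> g (\<epsilon>, Skip)"
    and super: "\<And>\<epsilon> s D. step \<pi> \<epsilon> s = Some D \<Longrightarrow> measure_pmf.expectation D g \<le> g (\<epsilon>, s)"
    and "finite F" "F \<subseteq> final_paths \<pi> \<sigma>"
  shows "(\<Sum>\<omega>\<in>F. path_prob \<pi> \<omega> * r (last \<omega>)) \<le> g \<sigma>"
proof -
  \<comment> \<open>Induction on a bound \<open>n\<close> for the path lengths; \<open>F\<close> and
    \<open>\<sigma>\<close> vary because removing the first state changes both.\<close>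
  have "(\<Sum>\<omega>\<in>F. path_prob \<pi> \<omega> * r (last \<omega>)) \<le> g \<sigma>"
    if "\<forall>\<omega>\<in>F. length \<omega> \<le> n" "finite F" "F \<subseteq> final_paths \<pi> \<sigma>" for n F \<sigma>
    using that
  proof (induction n arbitrary: F \<sigma>)
    case 0
    then have "F = {}" by (auto simp: final_paths_def)
    then show ?case by (simp add: assms)
  next
    case (Suc n)
    obtain \<epsilon> s where \<sigma>: "\<sigma> = (\<epsilon>, s)" by fastforce
    show ?case
    proof (cases "step \<pi> \<epsilon> s")
      case None
      show ?thesis
      proof (cases "s = Skip")
        case True
        then have "F = {} \<or> F = {[(\<epsilon>, Skip)]}"
          using Suc.prems by (auto simp: \<sigma> final_paths_Skip)
        then show ?thesis using Skip[of \<epsilon>] assms(2) True by (auto simp: \<sigma> path_prob_def)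
      next
        case False
        then show ?thesis using Suc.prems None assms(2) by (simp add: \<sigma> final_paths_stuck)
      qed
    next
      case (Some D)
      \<comment> \<open>\<open>G \<sigma>'\<close> collects the tails that start in the successor
        \<open>\<sigma>'\<close>. They have length at most \<open>n\<close>, so the induction
        hypothesis applies to each group.\<close>
      define G where "G \<sigma>' = {\<omega> \<in> tl ` F. hd \<omega> = \<sigma>'}" for \<sigma>'
      have split: "\<omega> = \<sigma> # tl \<omega> \<and> hd (tl \<omega>) \<in> set_pmf D \<and> tl \<omega> \<in> final_paths \<pi> (hd (tl \<omega>))"
        if \<omega>: "\<omega> \<in> F" for \<omega>
      proof -
        obtain \<sigma>' \<omega>' where "\<omega> = \<sigma> # \<omega>'" "\<sigma>' \<in> set_pmf D" "\<omega>' \<in> final_paths \<pi> \<sigma>'"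
          using \<omega> Suc.prems(3) unfolding \<sigma> final_paths_step[OF Some] by blast
        moreover from this have "hd \<omega>' = \<sigma>'" by (simp add: final_paths_def)
        ultimately show ?thesis by simp
      qed
      have F: "F = Cons \<sigma> ` tl ` F"
        using split by (auto simp: image_image intro!: image_eqI)
      have hd: "hd ` tl ` F \<subseteq> set_pmf D"
        and tl: "\<And>\<omega>. \<omega> \<in> tl ` F \<Longrightarrow> \<omega> \<in> final_paths \<pi> (hd \<omega>)"
        using split by blast+
      have ne: "\<omega> \<noteq> []" if "\<omega> \<in> tl ` F" for \<omega>
        using tl[OF that] by (auto simp: final_paths_def)
      have "(\<Sum>\<omega>\<in>F. path_prob \<pi> \<omega> * r (last \<omega>)) =
        (\<Sum>\<omega>\<in>tl ` F. path_prob \<pi> (\<sigma> # \<omega>) * r (last (\<sigma> # \<omega>)))"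
        by (subst F, subst sum.reindex) auto
      also have "\<dots> = (\<Sum>\<omega>\<in>tl ` F. pmf D (hd \<omega>) * (path_prob \<pi> \<omega> * r (last \<omega>)))"
        by (intro sum.cong) (auto simp: path_prob_Cons ne trans_prob_def \<sigma> Some simp del: image_iff)
      also have "\<dots> = (\<Sum>\<sigma>'\<in>set_pmf D. \<Sum>\<omega>\<in>G \<sigma>'. pmf D (hd \<omega>) * (path_prob \<pi> \<omega> * r (last \<omega>)))"
        unfolding G_def
        by (rule sum.group[symmetric]) (use Suc.prems hd finite_set_pmf_step[OF Some] in auto)
      also have "\<dots> = (\<Sum>\<sigma>'\<in>set_pmf D. (\<Sum>\<omega>\<in>G \<sigma>'. path_prob \<pi> \<omega> * r (last \<omega>)) * pmf D \<sigma>')"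
        by (auto simp: G_def sum_distrib_right intro!: sum.cong)
      also have "\<dots> \<le> (\<Sum>\<sigma>'\<in>set_pmf D. g \<sigma>' * pmf D \<sigma>')"
      proof (intro sum_mono mult_right_mono Suc.IH)
        show "\<forall>\<omega>\<in>G \<sigma>'. length \<omega> \<le> n" for \<sigma>'
          using Suc.prems(1) by (auto simp: G_def)
        show "G \<sigma>' \<subseteq> final_paths \<pi> \<sigma>'" for \<sigma>'
          using tl by (auto simp: G_def)
      qed (use Suc.prems(2) in \<open>auto simp: G_def\<close>)
      also have "\<dots> = measure_pmf.expectation D g"
        by (rule integral_measure_pmf_real[symmetric]) (auto simp: finite_set_pmf_step[OF Some])
      also have "\<dots> \<le> g \<sigma>"
        using super[OF Some] by (simp add: \<sigma>)
      finally show ?thesis .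
    qed
  qed
  from this[of F "Max (length ` F)"] show ?thesis
    using assms(5,6) by (auto simp: Max_ge)
qed

text \<open>The constant 1 is a supersolution for the reward 1, so finite sums of path probabilities
  never exceed 1.\<close>

lemma summable_path_prob: "(\<lambda>\<omega>. path_prob \<pi> \<omega>) summable_on final_paths \<pi> \<sigma>"
proof (rule nonneg_bdd_above_summable_on)
  show "bdd_above (sum (path_prob \<pi>) ` {F. F \<subseteq> final_paths \<pi> \<sigma> \<and> finite F})"
    using sum_final_paths_le_supersolution[of "\<lambda>_. 1" "\<lambda>_. 1" \<pi> _ \<sigma>]
    by (intro bdd_aboveI[of _ 1]) auto
qed (rule path_prob_nonneg)

text \<open>The instances used are indicators of formulae. The bound 1 gives summability by
  comparison with the path probabilities.\<close>

locale bounded_reward =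
  fixes r :: "'x state \<Rightarrow> real"
  assumes r_nonneg: "0 \<le> r \<sigma>" and r_le_1: "r \<sigma> \<le> 1"
begin

lemma summable_reward: "(\<lambda>\<omega>. path_prob \<pi> \<omega> * r (last \<omega>)) summable_on final_paths \<pi> \<sigma>"
  by (rule summable_on_comparison_test[OF summable_path_prob])
    (auto simp: r_nonneg r_le_1 path_prob_nonneg mult_left_le)

lemma reward_nonneg: "0 \<le> reward \<pi> r \<sigma>"
  by (simp add: reward_def infsum_nonneg path_prob_nonneg r_nonneg)

text \<open>The bound on finite sums passes to the infinite sum. As the reward is itself a
  supersolution, it is the least nonnegative one.\<close>

lemma reward_le_supersolution:
  assumes "\<And>\<sigma>. 0 \<le> g \<sigma>" "\<And>\<epsilon>. r (\<epsilon>, Skip) \<le> g (\<epsilon>, Skip)"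
    and "\<And>\<epsilon> s D. step \<pi> \<epsilon> s = Some D \<Longrightarrow> measure_pmf.expectation D g \<le> g (\<epsilon>, s)"
  shows "reward \<pi> r \<sigma> \<le> g \<sigma>"
  unfolding reward_def
  by (intro infsum_le_finite_sums summable_reward sum_final_paths_le_supersolution r_nonneg assms)

lemma reward_Skip: "reward \<pi> r (\<epsilon>, Skip) = r (\<epsilon>, Skip)"
  by (simp add: reward_def final_paths_Skip path_prob_def)

lemma reward_stuck: "step \<pi> \<epsilon> s = None \<Longrightarrow> s \<noteq> Skip \<Longrightarrow> reward \<pi> r (\<epsilon>, s) = 0"
  by (simp add: reward_def final_paths_stuck)

text \<open>A path is a first transition followed by a path of a successor. Paths of different
  successors start in different states, so the sum splits over the finite support.\<close>

lemma reward_step: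
  assumes "step \<pi> \<epsilon> s = Some D"
  shows "reward \<pi> r (\<epsilon>, s) = measure_pmf.expectation D (reward \<pi> r)"
proof -
  let ?f = "\<lambda>\<omega>. path_prob \<pi> \<omega> * r (last \<omega>)" and ?g = "\<lambda>\<omega>. pmf D (hd \<omega>) * (path_prob \<pi> \<omega> * r (last \<omega>))"
  have fin: "finite (set_pmf D)" using assms by (rule finite_set_pmf_step)
  have paths: "\<omega> \<noteq> [] \<and> hd \<omega> = \<sigma>" if "\<omega> \<in> final_paths \<pi> \<sigma>" for \<omega> \<sigma>
    using that by (auto simp: final_paths_def)
  have g: "(?g has_sum (pmf D \<sigma> * reward \<pi> r \<sigma>)) (final_paths \<pi> \<sigma>)" for \<sigma>
  proof -
    have "((\<lambda>\<omega>. pmf D \<sigma> * ?f \<omega>) has_sum (pmf D \<sigma> * reward \<pi> r \<sigma>)) (final_paths \<pi> \<sigma>)"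
      unfolding reward_def by (intro has_sum_cmult_right has_sum_infsum summable_reward)
    then show ?thesis
      by (rule has_sum_cong[THEN iffD1, rotated]) (use paths in auto)
  qed
  have "reward \<pi> r (\<epsilon>, s) = infsum (?f \<circ> Cons (\<epsilon>, s)) (\<Union>\<sigma>\<in>set_pmf D. final_paths \<pi> \<sigma>)"
    unfolding reward_def final_paths_step[OF assms] by (rule infsum_reindex) simp
  also have "\<dots> = infsum ?g (\<Union>\<sigma>\<in>set_pmf D. final_paths \<pi> \<sigma>)"
    by (rule infsum_cong) (use paths in \<open>auto simp: path_prob_Cons trans_prob_def assms\<close>)
  also have "\<dots> = (\<Sum>\<sigma>\<in>set_pmf D. infsum ?g (final_paths \<pi> \<sigma>))"
  proof (rule sum_infsum[symmetric])
    show "?g summable_on final_paths \<pi> \<sigma>" for \<sigma>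
      using g by (rule has_sum_imp_summable)
    show "final_paths \<pi> \<sigma> \<inter> final_paths \<pi> \<sigma>' = {}" if "\<sigma> \<noteq> \<sigma>'" for \<sigma> \<sigma>'
      using that paths by blast
  qed (rule fin)
  also have "\<dots> = (\<Sum>\<sigma>\<in>set_pmf D. reward \<pi> r \<sigma> * pmf D \<sigma>)"
    using g by (intro sum.cong) (auto dest!: infsumI simp: mult.commute)
  also have "\<dots> = measure_pmf.expectation D (reward \<pi> r)"
    by (rule integral_measure_pmf_real[symmetric]) (auto simp: fin)
  finally show ?thesis .
qed

text \<open>Both states have the same transitions, except that \<open>Skip ;; Skip\<close> takes one
  step to \<open>Skip\<close>, which leaves the reward unchanged.\<close>

lemma reward_Skip_Seq: "reward \<pi> r (\<epsilon>, Skip ;; s) = reward \<pi> r (\<epsilon>, s)"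
proof (cases "s = Skip")
  case True
  then show ?thesis by (subst reward_step) auto
next
  case False
  then have "step \<pi> \<epsilon> (Skip ;; s) = step \<pi> \<epsilon> s" by simp
  with False show ?thesis
    by (cases "step \<pi> \<epsilon> s") (simp_all add: reward_stuck reward_step)
qed

text \<open>Policies do not see the continuation of a program, so a fixed policy makes the same choices in
  \<open>s\<^sub>1 ;; (s\<^sub>2 ;; s\<^sub>3)\<close> and in \<open>(s\<^sub>1 ;; s\<^sub>2) ;; s\<^sub>3\<close>.\<close>

lemma reward_Seq_assoc_le:
  "reward \<pi> r (\<epsilon>, s\<^sub>1 ;; (s\<^sub>2 ;; s\<^sub>3)) \<le> reward \<pi> r (\<epsilon>, (s\<^sub>1 ;; s\<^sub>2) ;; s\<^sub>3)"
proof -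
  let ?V = "reward \<pi> r"
  \<comment> \<open>The candidate supersolution: on states
    \<open>s ;; s\<^sub>2 ;; s\<^sub>3\<close> the reward is capped by that of the other bracketing.
    The minimum keeps \<open>g\<close> below \<open>?V\<close> everywhere, so successors of any
    shape are covered.\<close>
  define g where "g \<sigma> = (case \<sigma> of
      (\<epsilon>, s ;; t) \<Rightarrow> if t = s\<^sub>2 ;; s\<^sub>3 then min (?V \<sigma>) (?V (\<epsilon>, (s ;; s\<^sub>2) ;; s\<^sub>3)) else ?V \<sigma>
    | _ \<Rightarrow> ?V \<sigma>)" for \<sigma>
  have g_le: "g \<sigma> \<le> ?V \<sigma>" for \<sigma>
    by (auto simp: g_def split: prod.split stmt.split)
  have g_assoc: "g (\<epsilon>, s ;; s\<^sub>2 ;; s\<^sub>3) = min (?V (\<epsilon>, s ;; s\<^sub>2 ;; s\<^sub>3)) (?V (\<epsilon>, (s ;; s\<^sub>2) ;; s\<^sub>3))" for \<epsilon> s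
    by (simp add: g_def)
  have E_mono: "measure_pmf.expectation D f \<le> measure_pmf.expectation D h"
    if "finite (set_pmf D)" "\<And>\<sigma>. f \<sigma> \<le> h \<sigma>" for D :: "'c pmf" and f h :: "'c \<Rightarrow> real"
    using that by (intro integral_mono integrable_measure_pmf_finite) auto
  have le_V: "measure_pmf.expectation D g \<le> ?V (\<epsilon>, s)" if "step \<pi> \<epsilon> s = Some D" for \<epsilon> s D
    unfolding reward_step[OF that] using finite_set_pmf_step[OF that] g_le by (rule E_mono)
  have le_assoc: "measure_pmf.expectation D g \<le> ?V (\<epsilon>, (s ;; s\<^sub>2) ;; s\<^sub>3)"
    if D: "step \<pi> \<epsilon> (s ;; s\<^sub>2 ;; s\<^sub>3) = Some D" for \<epsilon> s D
  proof (cases "s = Skip")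
    \<comment> \<open>While \<open>s\<close> is running, both bracketings move in lockstep and their
      successors again differ only by reassociation.\<close>
    case False
    then obtain D' where D': "step \<pi> \<epsilon> s = Some D'"
      and D_eq: "D = map_pmf (\<lambda>(\<epsilon>', s). (\<epsilon>', s ;; s\<^sub>2 ;; s\<^sub>3)) D'"
      using D by auto
    have "step \<pi> \<epsilon> ((s ;; s\<^sub>2) ;; s\<^sub>3) = Some (map_pmf (\<lambda>(\<epsilon>', s). (\<epsilon>', (s ;; s\<^sub>2) ;; s\<^sub>3)) D')"
      using False by (simp add: D' pmf.map_comp o_def case_prod_unfold)
    from reward_step[OF this] show ?thesis
      by (auto simp: D_eq g_assoc case_prod_unfold intro!: E_mono finite_set_pmf_step[OF D'])
  next
    case True
    show ?thesis
    proof (cases "s\<^sub>2 = Skip")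
      \<comment> \<open>Here \<open>(Skip ;; Skip) ;; s\<^sub>3\<close> spends a step on reaching
        \<open>Skip ;; s\<^sub>3\<close>, whereas \<open>Skip ;; Skip ;; s\<^sub>3\<close> passes
        over both leading \<open>Skip\<close>s at once; \<open>reward_Skip_Seq\<close> absorbs the
        difference.\<close>
      case s2: True
      have "?V (\<epsilon>, (s ;; s\<^sub>2) ;; s\<^sub>3) = ?V (\<epsilon>, Skip ;; s\<^sub>3)"
        using True s2 by (subst reward_step) auto
      also have "\<dots> = ?V (\<epsilon>, s ;; s\<^sub>2 ;; s\<^sub>3)"
        by (simp add: True s2 reward_Skip_Seq)
      finally show ?thesis using le_V[OF D] by simp
    next
      \<comment> \<open>With \<open>s\<close> finished and \<open>s\<^sub>2\<close> not, both
        bracketings have the same successor distribution \<open>D\<close>.\<close>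
      case False
      then have "step \<pi> \<epsilon> ((s ;; s\<^sub>2) ;; s\<^sub>3) = Some D"
        using D True by simp
      then show ?thesis by (rule le_V)
    qed
  qed
  have "?V (\<epsilon>, s\<^sub>1 ;; s\<^sub>2 ;; s\<^sub>3) \<le> g (\<epsilon>, s\<^sub>1 ;; s\<^sub>2 ;; s\<^sub>3)"
  proof (rule reward_le_supersolution)
    show "0 \<le> g \<sigma>" for \<sigma>
      by (auto simp: g_def reward_nonneg split: prod.split stmt.split)
    show "r (\<epsilon>, Skip) \<le> g (\<epsilon>, Skip)" for \<epsilon>
      by (simp add: g_def reward_Skip)
    show "measure_pmf.expectation D g \<le> g (\<epsilon>, s)" if "step \<pi> \<epsilon> s = Some D" for \<epsilon> s D
    proof (cases "\<exists>s'. s = s' ;; s\<^sub>2 ;; s\<^sub>3")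
      case True
      then show ?thesis using that le_V le_assoc by (force simp: g_assoc)
    next
      case False
      then have "g (\<epsilon>, s) = ?V (\<epsilon>, s)" by (auto simp: g_def split: stmt.split)
      then show ?thesis using le_V[OF that] by simp
    qed
  qed
  then show ?thesis by (simp add: g_assoc)
qed

text \<open>An infimum of reals behaves as a greatest lower bound only on a nonempty set that is
  bounded below: policies exist, and rewards are nonnegative.\<close>

lemma le_expected_iff:
  "c \<le> expected \<sigma> r \<longleftrightarrow> (\<forall>\<pi>. is_policy \<pi> \<longrightarrow> c \<le> reward \<pi> r \<sigma>)"
proof -
  \<comment> \<open>The policy that always takes the left branch; its value away from demonic
    choices is arbitrary.\<close>
  have "is_policy (\<lambda>(\<epsilon>, s). case s of Demon s\<^sub>1 s\<^sub>2 \<Rightarrow> s\<^sub>1 | _ \<Rightarrow> Skip)"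
    by (simp add: is_policy_def)
  then have "{\<pi> :: 'x policy. is_policy \<pi>} \<noteq> {}" by blast
  moreover have "bdd_below ((\<lambda>\<pi>. reward \<pi> r \<sigma>) ` {\<pi>. is_policy \<pi>})"
    by (rule bdd_belowI[of _ 0]) (auto simp: reward_nonneg)
  ultimately show ?thesis
    by (simp add: expected_def reward_def[symmetric] le_cINF_iff)
qed

end

section \<open>Soundness\<close>

text \<open>From a stuck nonfinal state the probability of termination is an empty sum, hence 0 and
  not 1. In this way the standing assumption yields Boolean guards and choice probabilities in the
  unit interval.\<close>

lemma terminates_not_stuck:
  assumes "terminates s" "s \<noteq> Skip" "is_policy \<pi>"
  obtains D where "step \<pi> \<epsilon> s = Some D"
proof (cases "step \<pi> \<epsilon> s")
  case None
  then have "final_paths \<pi> (\<epsilon>, s) = {}" using assms(2) by (rule final_paths_stuck)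
  moreover have "(\<Sum>\<^sub>\<infinity>\<omega>\<in>final_paths \<pi> (\<epsilon>, s). path_prob \<pi> \<omega>) = 1"
    using assms(1,3) by (simp add: terminates_def)
  ultimately show thesis by simp
next
  case (Some D)
  then show thesis by (rule that)
qed

section \<open>Semantics of updates and boxes\<close>

lemma sat_Upds: "sat \<rho> \<eta> \<epsilon> (Upds us \<phi>) \<longleftrightarrow> sat \<rho> \<eta> (upds_sem \<eta> \<epsilon> us) \<phi>"
  by (induction us arbitrary: \<epsilon>) (auto simp: Upds_def upds_sem_def)

lemma programs_Upds: "programs (Upds us \<phi>) = programs \<phi>"
  by (induction us) (auto simp: Upds_def)

lemma eval_term_of_exp: "eval (case_sum \<epsilon> \<eta>) (term_of_exp e) = eval \<epsilon> e"
  by (induction e) auto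

text \<open>Replaces the infimum by a condition on each policy, so that the rules reduce to
  equations and inequalities for \<open>reward\<close>.\<close>

lemma sat_Box_iff:
  "sat \<rho> \<eta> \<epsilon> (Box s p \<phi>) \<longleftrightarrow>
    (\<forall>\<pi>. is_policy \<pi> \<longrightarrow> \<rho> p \<le> reward \<pi> (\<lambda>\<sigma>. of_bool (sat \<rho> \<eta> (fst \<sigma>) \<phi>)) (\<epsilon>, s))"
proof -
  interpret bounded_reward "\<lambda>\<sigma>. of_bool (sat \<rho> \<eta> (fst \<sigma>) \<phi>)" by unfold_locales auto
  show ?thesis by (simp add: le_expected_iff)
qed

text \<open>Each rule is checked for one fixed assignment \<open>\<rho>\<close>. Termination of the
  programs in the conclusion excludes stuck choices and conditionals.\<close>

lemma infer_sound:
  assumes "infer R js C j" and "sound_rules R" and "satisfies \<rho> C"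
    and "\<forall>s\<in>sequent_programs j. terminates s" and "\<forall>i\<in>set js. valid \<rho> i"
  shows "valid \<rho> j"
  using assms
proof cases
  case fo
  then show ?thesis using assms(2,3,5) by (auto simp: sound_rules_def satisfies_def)
next
  case (skip \<Gamma> us s p \<phi>)
  interpret bounded_reward "\<lambda>\<sigma>. of_bool (sat \<rho> \<eta> (fst \<sigma>) \<phi>)" for \<eta> by unfold_locales auto
  show ?thesis using assms(5)
    by (auto simp: skip sat_imp_def sat_Upds sat_Box_iff reward_Skip_Seq simp del: sat.simps(5))
next
  case (assign \<Gamma> us x e s p \<phi>)
  interpret bounded_reward "\<lambda>\<sigma>. of_bool (sat \<rho> \<eta> (fst \<sigma>) \<phi>)" for \<eta> by unfold_locales auto
  have "reward \<pi> (\<lambda>\<sigma>. of_bool (sat \<rho> \<eta> (fst \<sigma>) \<phi>)) (\<epsilon>, Assign x e ;; s) =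
      reward \<pi> (\<lambda>\<sigma>. of_bool (sat \<rho> \<eta> (fst \<sigma>) \<phi>)) (\<epsilon>(x := eval \<epsilon> e), s)" for \<pi> \<eta> \<epsilon>
    by (subst reward_step) (auto simp: reward_Skip_Seq)
  then show ?thesis using assms(5)
    by (auto simp: assign sat_imp_def sat_Upds sat_Box_iff eval_term_of_exp simp del: sat.simps(5))
next
  case (empty1 \<Gamma> us \<phi> p)
  interpret bounded_reward "\<lambda>\<sigma>. of_bool (sat \<rho> \<eta> (fst \<sigma>) \<phi>)" for \<eta> by unfold_locales auto
  show ?thesis using assms(3,5)
    by (auto simp: empty1 sat_imp_def sat_Upds sat_Box_iff reward_Skip satisfies_def simp del: sat.simps(5))
next
  case (empty0 p \<Gamma> us \<phi>)
  interpret bounded_reward "\<lambda>\<sigma>. of_bool (sat \<rho> \<eta> (fst \<sigma>) \<phi>)" for \<eta> by unfold_locales auto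
  show ?thesis using assms(3)
    by (auto simp: empty0 sat_imp_def sat_Upds sat_Box_iff reward_nonneg satisfies_def simp del: sat.simps(5))
next
  case (demonChoice \<Gamma> us s\<^sub>1 s p\<^sub>1 \<phi> s\<^sub>2 p\<^sub>2 p)
  interpret bounded_reward "\<lambda>\<sigma>. of_bool (sat \<rho> \<eta> (fst \<sigma>) \<phi>)" for \<eta> by unfold_locales auto
  have "sat \<rho> \<eta> \<epsilon> (Box (Demon s\<^sub>1 s\<^sub>2 ;; s) p \<phi>)"
    if "sat \<rho> \<eta> \<epsilon> (Box (s\<^sub>1 ;; s) p\<^sub>1 \<phi>)" "sat \<rho> \<eta> \<epsilon> (Box (s\<^sub>2 ;; s) p\<^sub>2 \<phi>)" for \<eta> \<epsilon>
    unfolding sat_Box_iff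
  proof (intro allI impI)
    fix \<pi> :: "'a policy" assume \<pi>: "is_policy \<pi>"
    let ?V = "reward \<pi> (\<lambda>\<sigma>. of_bool (sat \<rho> \<eta> (fst \<sigma>) \<phi>))"
    \<comment> \<open>The policy is asked about the bare choice, without the continuation
      \<open>s\<close>.\<close>
    have "?V (\<epsilon>, Demon s\<^sub>1 s\<^sub>2 ;; s) = ?V (\<epsilon>, \<pi> (\<epsilon>, Demon s\<^sub>1 s\<^sub>2) ;; s)"
      by (subst reward_step) auto
    moreover have "\<pi> (\<epsilon>, Demon s\<^sub>1 s\<^sub>2) \<in> {s\<^sub>1, s\<^sub>2}"
      using \<pi> by (simp add: is_policy_def)
    moreover have "\<rho> p\<^sub>1 \<le> ?V (\<epsilon>, s\<^sub>1 ;; s)" "\<rho> p\<^sub>2 \<le> ?V (\<epsilon>, s\<^sub>2 ;; s)"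
      using that \<pi> unfolding sat_Box_iff by blast+
    moreover have "\<rho> p \<le> \<rho> p\<^sub>1" "\<rho> p \<le> \<rho> p\<^sub>2"
      using assms(3) by (auto simp: demonChoice satisfies_def)
    ultimately show "\<rho> p \<le> ?V (\<epsilon>, Demon s\<^sub>1 s\<^sub>2 ;; s)" by auto
  qed
  then show ?thesis using assms(5)
    by (auto simp: demonChoice sat_imp_def sat_Upds simp del: sat.simps(5))
next
  case (probChoice \<Gamma> us s\<^sub>1 s p\<^sub>1 \<phi> s\<^sub>2 p\<^sub>2 p e)
  interpret bounded_reward "\<lambda>\<sigma>. of_bool (sat \<rho> \<eta> (fst \<sigma>) \<phi>)" for \<eta> by unfold_locales auto
  have halts: "terminates (PChoice s\<^sub>1 e s\<^sub>2 ;; s)"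
    using assms(4) by (simp add: probChoice programs_Upds)
  have "sat \<rho> \<eta> \<epsilon> (Box (PChoice s\<^sub>1 e s\<^sub>2 ;; s) p \<phi>)"
    if "sat \<rho> \<eta> \<epsilon> (Box (s\<^sub>1 ;; s) p\<^sub>1 \<phi>)" "sat \<rho> \<eta> \<epsilon> (Box (s\<^sub>2 ;; s) p\<^sub>2 \<phi>)"
      and mix: "\<rho> p \<le> num (eval \<epsilon> e) * \<rho> p\<^sub>1 + (1 - num (eval \<epsilon> e)) * \<rho> p\<^sub>2" for \<eta> \<epsilon>
    unfolding sat_Box_iff
  proof (intro allI impI)
    fix \<pi> :: "'a policy" assume \<pi>: "is_policy \<pi>"
    let ?V = "reward \<pi> (\<lambda>\<sigma>. of_bool (sat \<rho> \<eta> (fst \<sigma>) \<phi>))"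
    \<comment> \<open>As the choice is not stuck, \<open>e\<close> evaluates to a number in the unit
      interval, and the side condition bounds \<open>\<rho> p\<close> by a convex
      combination.\<close>
    obtain D where D: "step \<pi> \<epsilon> (PChoice s\<^sub>1 e s\<^sub>2 ;; s) = Some D"
      using terminates_not_stuck[OF halts _ \<pi>] by blast
    then obtain v where v: "eval \<epsilon> e = VNum v" "0 \<le> v" "v \<le> 1"
      by (auto split: val.splits if_splits)
    with D have "?V (\<epsilon>, PChoice s\<^sub>1 e s\<^sub>2 ;; s) = v * ?V (\<epsilon>, s\<^sub>1 ;; s) + (1 - v) * ?V (\<epsilon>, s\<^sub>2 ;; s)"
      by (subst reward_step[OF D]) (auto simp: algebra_simps)
    moreover have "\<rho> p\<^sub>1 \<le> ?V (\<epsilon>, s\<^sub>1 ;; s)" "\<rho> p\<^sub>2 \<le> ?V (\<epsilon>, s\<^sub>2 ;; s)"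
      using that \<pi> unfolding sat_Box_iff by blast+
    then have "v * \<rho> p\<^sub>1 + (1 - v) * \<rho> p\<^sub>2 \<le> v * ?V (\<epsilon>, s\<^sub>1 ;; s) + (1 - v) * ?V (\<epsilon>, s\<^sub>2 ;; s)"
      using v by (intro add_mono mult_left_mono) auto
    ultimately show "\<rho> p \<le> ?V (\<epsilon>, PChoice s\<^sub>1 e s\<^sub>2 ;; s)"
      using mix v by simp
  qed
  then show ?thesis using assms(3,5)
    by (auto simp: probChoice sat_imp_def sat_Upds satisfies_def Let_def simp del: sat.simps(5))
next
  case (cond us e \<Gamma> s\<^sub>1 s p \<phi> s\<^sub>2)
  interpret bounded_reward "\<lambda>\<sigma>. of_bool (sat \<rho> \<eta> (fst \<sigma>) \<phi>)" for \<eta> by unfold_locales auto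
  have halts: "terminates (IfElse e s\<^sub>1 s\<^sub>2 ;; s)"
    using assms(4) by (simp add: cond programs_Upds)
  have "sat \<rho> \<eta> \<epsilon> (Box (IfElse e s\<^sub>1 s\<^sub>2 ;; s) p \<phi>)"
    if "eval \<epsilon> e = VBool True \<Longrightarrow> sat \<rho> \<eta> \<epsilon> (Box (s\<^sub>1 ;; s) p \<phi>)"
      "eval \<epsilon> e \<noteq> VBool True \<Longrightarrow> sat \<rho> \<eta> \<epsilon> (Box (s\<^sub>2 ;; s) p \<phi>)" for \<eta> \<epsilon>
    unfolding sat_Box_iff
  proof (intro allI impI)
    fix \<pi> :: "'a policy" assume \<pi>: "is_policy \<pi>"
    let ?V = "reward \<pi> (\<lambda>\<sigma>. of_bool (sat \<rho> \<eta> (fst \<sigma>) \<phi>))"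
    \<comment> \<open>The second premise covers every guard value other than
      \<open>VBool True\<close>. As the conditional is not stuck, the guard is Boolean, so the
      remaining value is \<open>VBool False\<close>.\<close>
    obtain D where D: "step \<pi> \<epsilon> (IfElse e s\<^sub>1 s\<^sub>2 ;; s) = Some D"
      using terminates_not_stuck[OF halts _ \<pi>] by blast
    then obtain b where b: "eval \<epsilon> e = VBool b"
      by (auto split: val.splits)
    with D have "?V (\<epsilon>, IfElse e s\<^sub>1 s\<^sub>2 ;; s) = ?V (\<epsilon>, (if b then s\<^sub>1 else s\<^sub>2) ;; s)"
      by (subst reward_step[OF D]) auto
    then show "\<rho> p \<le> ?V (\<epsilon>, IfElse e s\<^sub>1 s\<^sub>2 ;; s)"
      using that \<pi> b unfolding sat_Box_iff by (cases b) auto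
  qed
  then show ?thesis using assms(5)
    by (auto simp: cond sat_imp_def sat_Upds eval_term_of_exp simp del: sat.simps(5))
next
  case (loopUnroll \<Gamma> us e s\<^sub>b s p \<phi>)
  interpret bounded_reward "\<lambda>\<sigma>. of_bool (sat \<rho> \<eta> (fst \<sigma>) \<phi>)" for \<eta> by unfold_locales auto
  have "reward \<pi> (\<lambda>\<sigma>. of_bool (sat \<rho> \<eta> (fst \<sigma>) \<phi>)) (\<epsilon>, IfElse e (s\<^sub>b ;; While e s\<^sub>b ;; s) s)
      \<le> reward \<pi> (\<lambda>\<sigma>. of_bool (sat \<rho> \<eta> (fst \<sigma>) \<phi>)) (\<epsilon>, While e s\<^sub>b ;; s)"
    (is "?V (_, ?if) \<le> ?V (_, ?while)") for \<pi> \<eta> \<epsilon>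
  proof (cases "eval \<epsilon> e")
    \<comment> \<open>On a guard that is not Boolean the conditional is stuck with reward 0, whereas
      the loop exits. Hence in general only an inequality holds.\<close>
    case (VNum v)
    then have "?V (\<epsilon>, ?if) = 0" by (simp add: reward_stuck)
    then show ?thesis by (simp add: reward_nonneg)
  next
    case (VBool b)
    then have "?V (\<epsilon>, ?if) = ?V (\<epsilon>, if b then s\<^sub>b ;; While e s\<^sub>b ;; s else s)"
      by (subst reward_step) auto
    moreover have "?V (\<epsilon>, ?while) = ?V (\<epsilon>, (if b then s\<^sub>b ;; While e s\<^sub>b else Skip) ;; s)"
      using VBool by (subst reward_step) auto
    \<comment> \<open>For a true guard the two sides differ by bracketing, for a false one by a
      leading \<open>Skip\<close>.\<close>
    ultimately show ?thesis
      by (simp add: reward_Seq_assoc_le reward_Skip_Seq)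
  qed
  then have "sat \<rho> \<eta> \<epsilon> (Box (While e s\<^sub>b ;; s) p \<phi>)"
    if "sat \<rho> \<eta> \<epsilon> (Box (IfElse e (s\<^sub>b ;; While e s\<^sub>b ;; s) s) p \<phi>)" for \<eta> \<epsilon>
    using that unfolding sat_Box_iff by (meson order_trans)
  then show ?thesis using assms(5)
    by (auto simp: loopUnroll sat_imp_def sat_Upds simp del: sat.simps(5))
qed

text \<open>Side conditions and programs of a subtree are among those of the whole tree, so a single
  assignment and the termination hypothesis serve at every node.\<close>

lemma proof_tree_sound:
  assumes "proof_tree R T" and "sound_rules R" and "satisfies \<rho> (side_conds T)"
    and "\<forall>s\<in>tree_programs T. terminates s"
  shows "valid \<rho> (concl T)"
  using assms(1,3,4)
proof (induction rule: proof_tree.induct)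
  case (1 ts C j)
  have "valid \<rho> (concl t)" if "t \<in> set ts" for t
  proof (rule 1(3)[OF that])
    show "satisfies \<rho> (side_conds t)" using 1(4) that by (auto simp: satisfies_def)
    show "\<forall>s\<in>tree_programs t. terminates s" using 1(5) that by auto
  qed
  moreover have "satisfies \<rho> C" "\<forall>s\<in>sequent_programs j. terminates s"
    using 1 by (auto simp: satisfies_def)
  ultimately show ?case
    using infer_sound[OF 1(1) assms(2)] by auto
qed

theorem theorem1:
  fixes \<Gamma> :: "('x, 'l, 'p) fml fset" and \<phi> :: "('x, 'l, 'p) fml"
    and R :: "('x, 'l, 'p) rules" and T :: "('x, 'l, 'p) tree"
  assumes "sound_rules R"
    and "proof_tree R T"
    and "concl T = (\<Gamma> \<turnstile> \<phi>)"
    and "satisfiable (side_conds T)"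
    and "\<forall>s\<in>tree_programs T. terminates s"
  shows "\<forall>\<rho>. satisfies \<rho> (side_conds T) \<longrightarrow> (\<forall>\<eta> \<epsilon>. sat_imp \<rho> \<eta> \<epsilon> \<Gamma> \<phi>)"
  using proof_tree_sound[OF assms(2,1)] assms(3,5) by force

end
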